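(* Suppose $P_{n,K}$ is full-dimensional. The inequality $$x_{1,2}+x_{1,3}+x_{2,3}-\sum_{i=4}^n x_i\ge 3-K$$ (which corresponds to $x_3+x_{1,3}+x_{2,3}\ge 1$ after substituting $x_3=K-2+x_{1,2}-\sum_{i=4}^n x_i$) is facet-defining for $P_{n,K}$.
   Context: $V=\{1,\dots,n\}$ and $E$ is the set of all unordered pairs $ij$ of distinct elements of $V$; $x_{i,j}=x_{j,i}$. A $K$-partition $\pi$ is a collection of $K$ non-empty pairwise disjoint subsets (clusters) of $V$ whose union is $V$. The representative of a cluster is its smallest element. The characteristic vector $x^\pi\in\{0,1\}^{|E|+|V|-3}$ of $\pi$ has components $x_4,\dots,x_n$ and $x_{i,j}$ for $ij\in E$, where $x^\pi_{i,j}=1$ if $i,j$ are in the same cluster and $0$ otherwise, and $x^\pi_u=1$ if $u$ is the representative of its cluster and $0$ otherwise. (Representative variables of vertices $1,2,3$ are not coordinates; they are eliminated via $x_1=1$, $x_2=1-x_{1,2}$, $x_3=K-2+x_{1,2}-\sum_{i=4}^n x_i$.) $P_{n,K}\subset\mathbb R^{|E|+|V|-3}$ is the convex hull of the characteristic vectors $x^\pi$ of all $K$-partitions $\pi$ of $V$ (equivalently, of all $0/1$ solutions of the integer formulation of the $K$-partitioning problem). It is full-dimensional (dimension $|E|+|V|-3$) if and only if $K\in\{3,\dots,n-2\}$. An inequality is facet-defining for $P_{n,K}$ if it is valid for $P_{n,K}$ and the set of points of $P_{n,K}$ satisfying it with equality has dimension $\dim(P_{n,K})-1$. *)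

theory Defs
  imports "HOL-Analysis.Analysis"
begin

text \<open>
  Labels of the coordinates of \<open>\<real>\<^sup>|\<^sup>E\<^sup>|\<^sup>+\<^sup>|\<^sup>V\<^sup>|\<^sup>-\<^sup>3\<close>: \<open>Edge {i, j}\<close> stands for \<open>x\<^sub>i\<^sub>,\<^sub>j\<close> (an unordered pair,
  so \<open>x\<^sub>i\<^sub>,\<^sub>j = x\<^sub>j\<^sub>,\<^sub>i\<close>) and \<open>Rep u\<close> for \<open>x\<^sub>u\<close>.
\<close>
datatype coord = Edge "nat set" | Rep nat

definition coords :: "nat \<Rightarrow> coord set" where
  "coords n = Edge ` {e. e \<subseteq> {1..n} \<and> card e = 2} \<union> Rep ` {4..n}"

definition K_partition :: "nat \<Rightarrow> nat \<Rightarrow> nat set set \<Rightarrow> bool" where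
  "K_partition n K \<pi> \<longleftrightarrow> partition_on {1..n} \<pi> \<and> card \<pi> = K"

fun coord_val :: "nat set set \<Rightarrow> coord \<Rightarrow> real" where
  "coord_val \<pi> (Edge e) = (if \<exists>C\<in>\<pi>. e \<subseteq> C then 1 else 0)"
| "coord_val \<pi> (Rep u) = (if \<exists>C\<in>\<pi>. u \<in> C \<and> u = Min C then 1 else 0)"

text \<open>
  Since the dimension depends on \<open>n\<close>, the ambient space is \<open>real ^ 'c\<close> for an arbitrary finite
  index type \<open>'c\<close>, together with a bijection \<open>pos\<close> from \<open>coords n\<close> onto \<open>'c\<close> that tells at which
  position each coordinate is stored: \<open>x\<^sub>i\<^sub>,\<^sub>j\<close> is \<open>x $ pos (Edge {i, j})\<close> and \<open>x\<^sub>u\<close> is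
  \<open>x $ pos (Rep u)\<close>.
\<close>
definition char_vec :: "nat \<Rightarrow> (coord \<Rightarrow> 'c) \<Rightarrow> nat set set \<Rightarrow> real ^ 'c::finite" where
  "char_vec n pos \<pi> = (\<chi> i. coord_val \<pi> (inv_into (coords n) pos i))"

definition partition_polytope :: "nat \<Rightarrow> nat \<Rightarrow> (coord \<Rightarrow> 'c) \<Rightarrow> (real ^ 'c::finite) set" where
  "partition_polytope n K pos = convex hull (char_vec n pos ` {\<pi>. K_partition n K \<pi>})"

text \<open>The inequality \<open>f x \<ge> b\<close>, for a linear form \<open>f\<close>, is facet-defining for \<open>P\<close>.\<close>
definition facet_defining :: "'a::euclidean_space set \<Rightarrow> ('a \<Rightarrow> real) \<Rightarrow> real \<Rightarrow> bool" where
  "facet_defining P f b \<longleftrightarrow>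
     linear f \<and> (\<forall>x\<in>P. f x \<ge> b) \<and> aff_dim {x \<in> P. f x = b} = aff_dim P - 1"

lemma char_vec_nth:
  assumes "bij_betw pos (coords n) UNIV" "c \<in> coords n"
  shows "char_vec n pos \<pi> $ pos c = coord_val \<pi> c"
  using assms by (simp add: char_vec_def bij_betw_def)

lemma card_coords:
  assumes "n \<ge> 3"
  shows "card (coords n) = card {e. e \<subseteq> {1..n} \<and> card e = 2} + n - 3"
proof -
  have "finite {e. e \<subseteq> {1..n} \<and> card e = 2}"
    by (rule finite_subset[of _ "Pow {1..n}"]) auto
  then have "card (coords n) = card (Edge ` {e. e \<subseteq> {1..n} \<and> card e = 2}) + card (Rep ` {4..n})"
    unfolding coords_def by (intro card_Un_disjoint) auto
  also have "\<dots> = card {e. e \<subseteq> {1..n} \<and> card e = 2} + card {4..n}"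
    by (simp add: card_image inj_on_def)
  finally show ?thesis
    using assms by simp
qed

end

theory Submission
  imports Defs
begin

text \<open>
  On a characteristic vector the slack of the inequality is 1 if 1, 2, 3 share a cluster and 0
  otherwise. Hence it suffices that every affine functional vanishing on all partitions
  separating 1, 2, 3 is constant on the partitions that do not: then a single vertex off the face
  raises the affine hull of the face to that of the whole polytope. To prove constancy, write
  \<open>a\<close> for the coefficients of the functional. Second differences over partitions on the face, moving
  vertex 3 and a vertex \<open>u \<ge> 4\<close> between three clusters, give \<open>a\<^sub>3\<^sub>u = 0\<close> and \<open>a\<^sub>u = a\<^sub>v\<close>. Moving
  vertex 3 away from 1 and 2 then shows that the value off the face does not depend on the partition.
  Full-dimensionality enters only to exclude \<open>K \<le> 2\<close> and \<open>K > n - 2\<close>, where the polytope lies in a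
  hyperplane.
\<close>

section \<open>Colourings in place of partitions\<close>

text \<open>A partition is encoded by numbering its clusters, in any order; surjectivity onto
  \<open>{..<K}\<close> says that no cluster is empty. Moving a vertex to another cluster then
  becomes a function update.\<close>

definition colouring :: "nat \<Rightarrow> nat \<Rightarrow> (nat \<Rightarrow> nat) \<Rightarrow> bool" where
  "colouring n K c \<longleftrightarrow> c ` {1..n} = {..<K}"

lemma colouring_less: "colouring n K c \<Longrightarrow> i \<in> {1..n} \<Longrightarrow> c i < K"
  unfolding colouring_def by (metis imageI lessThan_iff)

lemma colouring_surj:
  assumes "colouring n K c" "k < K"
  obtains i where "i \<in> {1..n}" "c i = k"
  using assms unfolding colouring_def by (metis imageE lessThan_iff)

text \<open>The \<open>Rep\<close> clause makes sense for every vertex, so the eliminated variables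
  of 1, 2, 3 have values here as well and can enter the count of all representatives.\<close>

fun colour_val :: "(nat \<Rightarrow> nat) \<Rightarrow> coord \<Rightarrow> real" where
  "colour_val c (Edge e) = of_bool (\<forall>i\<in>e. \<forall>j\<in>e. c i = c j)"
| "colour_val c (Rep u) = of_bool (\<forall>j\<in>{1..<u}. c j \<noteq> c u)"

lemma coords_cases:
  assumes "x \<in> coords n"
  obtains i j where "x = Edge {i, j}" "i \<noteq> j" "i \<in> {1..n}" "j \<in> {1..n}"
  | u where "x = Rep u" "u \<in> {4..n}"
proof -
  consider e where "x = Edge e" "e \<subseteq> {1..n}" "card e = 2" | u where "x = Rep u" "u \<in> {4..n}"
    using assms unfolding coords_def by blast
  then show ?thesis
  proof cases
    case (1 e)
    then obtain i j where "e = {i, j}" "i \<noteq> j"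
      by (auto simp: card_2_iff)
    with 1 that(1) show ?thesis by blast
  qed (rule that(2))
qed

lemma Edge_in_coords [simp]:
  "Edge {i, j} \<in> coords n \<longleftrightarrow> i \<noteq> j \<and> i \<in> {1..n} \<and> j \<in> {1..n}"
  by (cases "i = j") (auto simp: coords_def)

lemma Rep_in_coords [simp]: "Rep u \<in> coords n \<longleftrightarrow> u \<in> {4..n}"
  by (auto simp: coords_def)

lemma finite_coords [simp]: "finite (coords n)"
proof -
  have "finite {e. e \<subseteq> {1..n} \<and> card e = 2}"
    by (rule finite_subset[of _ "Pow {1..n}"]) auto
  then show ?thesis
    by (simp add: coords_def)
qed

lemma colour_val_Edge: "colour_val c (Edge {i, j}) = of_bool (c i = c j)"
  by auto

text \<open>For \<open>Rep u\<close>, the cluster \<open>C\<close> of \<open>u\<close> is unique,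
  and \<open>u = Min C\<close> means that no smaller vertex lies in \<open>C\<close>, that is, none
  has the colour of \<open>u\<close>.\<close>

lemma coord_val_eq_colour_val:
  assumes p: "partition_on {1..n} \<pi>"
    and c: "\<And>i j. i \<in> {1..n} \<Longrightarrow> j \<in> {1..n} \<Longrightarrow> c i = c j \<longleftrightarrow> (\<exists>C\<in>\<pi>. i \<in> C \<and> j \<in> C)"
    and x: "x \<in> coords n"
  shows "coord_val \<pi> x = colour_val c x"
  using x
proof (cases rule: coords_cases)
  case (1 i j)
  then show ?thesis using c[of i j] by auto
next
  case (2 u)
  from p 2 obtain C where C: "C \<in> \<pi>" "u \<in> C"
    by (metis Union_iff atLeastAtMost_iff le_trans numeral_One numeral_le_iff partition_onD1 semiring_norm(68))
  have sub: "C \<subseteq> {1..n}"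
    using p C by (auto simp: partition_on_def)
  have uniq: "D = C" if "D \<in> \<pi>" "u \<in> D" for D
    using p C that by (auto simp: partition_on_def disjoint_def)
  have "(\<exists>C\<in>\<pi>. u \<in> C \<and> u = Min C) \<longleftrightarrow> u = Min C"
    using C uniq by blast
  also have "\<dots> \<longleftrightarrow> (\<forall>j\<in>C. u \<le> j)"
    using C sub finite_subset[OF sub] by (metis Min_eqI Min_le finite_atLeastAtMost)
  also have "\<dots> \<longleftrightarrow> (\<forall>j\<in>{1..<u}. j \<notin> C)"
    using sub by force
  also have "\<dots> \<longleftrightarrow> (\<forall>j\<in>{1..<u}. c j \<noteq> c u)"
  proof -
    have "c j = c u \<longleftrightarrow> j \<in> C" if "j \<in> {1..n}" for j
    proof -
      have "c j = c u \<longleftrightarrow> (\<exists>D\<in>\<pi>. j \<in> D \<and> u \<in> D)"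
        by (rule c) (use that 2 in auto)
      then show ?thesis using C uniq by blast
    qed
    then show ?thesis using 2 by simp
  qed
  finally show ?thesis using 2 by simp
qed

text \<open>Each vertex is coloured with the number of its cluster under a bijection from the
  clusters to \<open>{..<K}\<close>.\<close>

lemma partition_imp_colouring:
  assumes "K_partition n K \<pi>"
  shows "\<exists>c. colouring n K c \<and> (\<forall>x\<in>coords n. coord_val \<pi> x = colour_val c x)"
proof -
  have p: "partition_on {1..n} \<pi>" and K: "card \<pi> = K"
    using assms by (auto simp: K_partition_def)
  have "finite \<pi>"
    using p finite_elements by blast
  then obtain b where b: "bij_betw b \<pi> {..<K}"
    using K by (metis card_lessThan finite_lessThan finite_same_card_bij)
  have "\<forall>i\<in>{1..n}. \<exists>C\<in>\<pi>. i \<in> C"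
    using p by (auto simp: partition_on_def)
  then obtain B where B: "\<And>i. i \<in> {1..n} \<Longrightarrow> B i \<in> \<pi>" "\<And>i. i \<in> {1..n} \<Longrightarrow> i \<in> B i"
    by metis
  have uniq: "C = B i" if "C \<in> \<pi>" "i \<in> C" "i \<in> {1..n}" for C i
    using p B[of i] that by (auto simp: partition_on_def disjoint_def)
  have "C \<in> B ` {1..n}" if "C \<in> \<pi>" for C
  proof -
    have "C \<noteq> {}" "C \<subseteq> {1..n}"
      using p that by (auto simp: partition_on_def)
    then obtain i where "i \<in> C" "i \<in> {1..n}" by blast
    then show ?thesis using uniq that by blast
  qed
  then have "B ` {1..n} = \<pi>"
    using B by blast
  then have col: "colouring n K (b \<circ> B)"
    using b unfolding colouring_def image_comp[symmetric] bij_betw_def by simp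
  have "coord_val \<pi> x = colour_val (b \<circ> B) x" if "x \<in> coords n" for x
  proof (rule coord_val_eq_colour_val[OF p _ that])
    fix i j assume ij: "i \<in> {1..n}" "j \<in> {1..n}"
    have "(b \<circ> B) i = (b \<circ> B) j \<longleftrightarrow> B i = B j"
      using inj_on_eq_iff[of b \<pi> "B i" "B j"] b B[OF ij(1)] B[OF ij(2)] by (simp add: bij_betw_def)
    also have "\<dots> \<longleftrightarrow> (\<exists>C\<in>\<pi>. i \<in> C \<and> j \<in> C)"
      using B[OF ij(1)] B[OF ij(2)] uniq[OF _ _ ij(1)] uniq[OF _ _ ij(2)] by metis
    finally show "(b \<circ> B) i = (b \<circ> B) j \<longleftrightarrow> (\<exists>C\<in>\<pi>. i \<in> C \<and> j \<in> C)" .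
  qed
  with col show ?thesis by blast
qed

lemma colouring_imp_partition:
  assumes "colouring n K c"
  shows "\<exists>\<pi>. K_partition n K \<pi> \<and> (\<forall>x\<in>coords n. coord_val \<pi> x = colour_val c x)"
proof -
  define B where "B = (\<lambda>k. {i\<in>{1..n}. c i = k})"
  have ne: "B k \<noteq> {}" if "k < K" for k
    using colouring_surj[OF assms that] unfolding B_def by blast
  note lt = colouring_less[OF assms]
  have p: "partition_on {1..n} (B ` {..<K})"
    using ne lt by (auto simp: partition_on_def disjoint_def B_def)
  have "inj_on B {..<K}"
  proof (rule inj_onI)
    fix k l assume "k \<in> {..<K}" "B k = B l"
    then obtain i where "i \<in> B k" "i \<in> B l" using ne by blast
    then show "k = l" by (simp add: B_def)
  qed
  then have "card (B ` {..<K}) = K"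
    by (simp add: card_image)
  moreover have "coord_val (B ` {..<K}) x = colour_val c x" if "x \<in> coords n" for x
    by (rule coord_val_eq_colour_val[OF p _ that]) (use lt in \<open>auto simp: B_def\<close>)
  ultimately show ?thesis
    using p unfolding K_partition_def by blast
qed

section \<open>Counting representatives and eliminating the variables of 1, 2, 3\<close>

text \<open>Every colour has exactly one first vertex, so \<open>c\<close> maps the representatives
  bijectively onto the colours.\<close>

lemma sum_Rep_colour_val:
  assumes "colouring n K c"
  shows "(\<Sum>i=1..n. colour_val c (Rep i)) = real K"
proof -
  let ?R = "{i\<in>{1..n}. \<forall>j\<in>{1..<i}. c j \<noteq> c i}"
  have "bij_betw c ?R {..<K}"
    unfolding bij_betw_def
  proof
    show "inj_on c ?R"
      by (rule linorder_inj_onI') force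
    show "c ` ?R = {..<K}"
    proof
      show "c ` ?R \<subseteq> {..<K}"
        using assms by (auto simp: colouring_def)
      show "{..<K} \<subseteq> c ` ?R"
      proof
        fix k assume "k \<in> {..<K}"
        then obtain i where i: "i \<in> {1..n}" "c i = k"
          using colouring_surj[OF assms] by blast
        define m where "m = (LEAST i. i \<in> {1..n} \<and> c i = k)"
        have m: "m \<in> {1..n} \<and> c m = k"
          unfolding m_def by (rule LeastI[of _ i]) (use i in simp)
        have "c j \<noteq> c m" if "j \<in> {1..<m}" for j
          using not_less_Least[of j "\<lambda>i. i \<in> {1..n} \<and> c i = k"] m that unfolding m_def[symmetric] by auto
        with m show "k \<in> c ` ?R" by blast
      qed
    qed
  qed
  then have "card ?R = K"
    using bij_betw_same_card by fastforce
  then show ?thesis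
    by (simp add: Int_def conj_commute)
qed

text \<open>Vertex 1 is always a representative, 2 is one unless it joins 1, and 3 is one unless it
  joins 1 or 2; these three terms are split off the total \<open>K\<close>.\<close>

lemma sum_Rep_from_4:
  assumes "colouring n K c" "n \<ge> 3"
  shows "(\<Sum>i=4..n. colour_val c (Rep i)) =
    real K - 1 - of_bool (c 1 \<noteq> c 2) - of_bool (c 1 \<noteq> c 3 \<and> c 2 \<noteq> c 3)"
proof -
  have "{1..n} = {1, 2, 3} \<union> {4..n}"
    using assms(2) by auto
  then have "(\<Sum>i=1..n. colour_val c (Rep i)) =
      (\<Sum>i\<in>{1,2,3}. colour_val c (Rep i)) + (\<Sum>i=4..n. colour_val c (Rep i))"
    by (simp only:) (rule sum.union_disjoint; auto)
  moreover have "colour_val c (Rep 1) = 1" "colour_val c (Rep 2) = of_bool (c 1 \<noteq> c 2)"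
    "colour_val c (Rep 3) = of_bool (c 1 \<noteq> c 3 \<and> c 2 \<noteq> c 3)"
  proof -
    have "{1..<2} = {1::nat}" "{1..<3} = {1::nat, 2}"
      by auto
    then show "colour_val c (Rep 1) = 1" "colour_val c (Rep 2) = of_bool (c 1 \<noteq> c 2)"
      "colour_val c (Rep 3) = of_bool (c 1 \<noteq> c 3 \<and> c 2 \<noteq> c 3)"
      by simp_all
  qed
  moreover have "(\<Sum>i\<in>{1,2,3}. colour_val c (Rep i)) =
      colour_val c (Rep 1) + colour_val c (Rep 2) + colour_val c (Rep 3)"
    by (simp del: colour_val.simps)
  ultimately show ?thesis
    using sum_Rep_colour_val[OF assms(1)] by linarith
qed

section \<open>Recolouring a vertex and second differences\<close>

text \<open>The vertex \<open>w\<close> keeps the old colour of \<open>v\<close> in use, so no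
  colour is lost.\<close>

lemma colouring_upd:
  assumes "colouring n K c" "w \<in> {1..n}" "w \<noteq> v" "c v = c w" "k < K" "v \<in> {1..n}"
  shows "colouring n K (c(v := k))"
proof -
  have "c ` ({1..n} - {v}) = c ` {1..n}"
    using assms(2,3,4) by (auto simp: image_iff) (metis DiffI atLeastAtMost_iff singletonD)
  then show ?thesis
    using assms unfolding colouring_def by (auto simp: fun_upd_image)
qed

definition colour_form :: "nat \<Rightarrow> (coord \<Rightarrow> real) \<Rightarrow> (nat \<Rightarrow> nat) \<Rightarrow> real" where
  "colour_form n a c = (\<Sum>x\<in>coords n. a x * colour_val c x)"

lemma mixed_difference:
  "colour_form n a c1 - colour_form n a c2 - colour_form n a c3 + colour_form n a c4 =
    (\<Sum>x\<in>coords n. a x * (colour_val c1 x - colour_val c2 x - colour_val c3 x + colour_val c4 x))"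
  by (simp add: colour_form_def sum.distrib sum_subtractf distrib_left right_diff_distrib)

text \<open>An edge other than \<open>{s, t}\<close> misses \<open>s\<close> or \<open>t\<close>, so
  its value is independent of one of the two new colours and the four terms cancel in pairs.\<close>

lemma Edge_mixed_difference:
  fixes c :: "nat \<Rightarrow> nat"
  assumes "i \<noteq> j" "s \<noteq> t"
  defines "d \<equiv> \<lambda>x y. c(s := x, t := y)"
  shows "colour_val (d x y) (Edge {i, j}) - colour_val (d x y') (Edge {i, j})
      - colour_val (d x' y) (Edge {i, j}) + colour_val (d x' y') (Edge {i, j}) =
    (if {i, j} = {s, t}
     then of_bool (x = y) - of_bool (x = y') - of_bool (x' = y) + of_bool (x' = y') else 0)"
proof -
  consider "i = s" "j = t" | "i = t" "j = s" | "s \<notin> {i, j}" | "t \<notin> {i, j}"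
    using assms by blast
  then show ?thesis
    unfolding colour_val_Edge by cases (use assms in \<open>auto simp: d_def doubleton_eq_iff\<close>)
qed

section \<open>Functionals constant on the face\<close>

text \<open>The coefficients \<open>a\<close> describe a functional equal to \<open>b\<close> at all
  vertices of the face, which are the colourings where 1, 2, 3 do not all share a colour.\<close>

locale face_form =
  fixes n K :: nat and a :: "coord \<Rightarrow> real" and b :: real
  assumes K3: "K \<ge> 3"
    and face: "\<And>c. colouring n K c \<Longrightarrow> \<not> (c 1 = c 2 \<and> c 2 = c 3) \<Longrightarrow> colour_form n a c = b"
begin

text \<open>Giving 2 the colour \<open>q\<close> separates it from 1, so 3 and \<open>u\<close> may
  move freely without leaving the face. With 3 in \<open>p\<close> or \<open>r\<close> and
  \<open>u\<close> in \<open>p\<close> or \<open>q\<close>, the two agree in only one of the four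
  colourings, and the second difference leaves just this edge.\<close>

lemma edge_3_eq_0:
  assumes c: "colouring n K c" "c 1 = p" "c 2 = p" "c 3 = p" "c u = p"
    and u: "u \<in> {4..n}"
    and q: "q < K" "r < K" "q \<noteq> p" "r \<noteq> p" "q \<noteq> r"
  shows "a (Edge {3, u}) = 0"
proof -
  define d where "d = (\<lambda>x y. c(2 := q, 3 := x, u := y))"
  have pK: "p < K"
    using colouring_less[OF c(1), of u] c u by simp
  have d: "colour_form n a (d x y) = b" if "x < K" "y < K" for x y
  proof (rule face)
    show "colouring n K (d x y)"
      unfolding d_def using c u q that
      by (intro colouring_upd[where w = 1]) auto
    show "\<not> (d x y 1 = d x y 2 \<and> d x y 2 = d x y 3)"
      unfolding d_def using c u q by auto
  qed
  \<comment> \<open>No representative depends on \<open>y\<close>: colours \<open>p\<close> and \<open>q\<close> are represented by 1 and 2.\<close>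
  have eq: "colour_val (d p p) x - colour_val (d p q) x - colour_val (d r p) x + colour_val (d r q) x =
      of_bool (x = Edge {3, u})" if "x \<in> coords n" for x
    using that
  proof (cases rule: coords_cases)
    case (1 i j)
    then show ?thesis
      using Edge_mixed_difference[of i j 3 u "c(2 := q)" p p q r] u q by (simp add: d_def)
  next
    case (2 w)
    have "colour_val (d z p) (Rep w) = colour_val (d z q) (Rep w)" for z
    proof (cases "w = u \<or> c w = p \<or> c w = q")
      case True
      have ex: "\<exists>j\<in>{1..<w}. d z y j = d z y w" if "y = p \<or> y = q" for y
      proof (cases "d z y w = p")
        case True
        then show ?thesis
          using 2 u c by (intro bexI[of _ 1]) (auto simp: d_def)
      next
        case False
        then show ?thesis
          using 2 u c that \<open>w = u \<or> c w = p \<or> c w = q\<close> by (intro bexI[of _ 2]) (auto simp: d_def)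
      qed
      have "colour_val (d z y) (Rep w) = 0" if "y = p \<or> y = q" for y
        using ex[OF that] by auto
      then show ?thesis
        by (simp del: colour_val.simps)
    next
      case False
      then show ?thesis
        using 2 u by (auto simp: d_def)
    qed
    then show ?thesis using 2 by simp
  qed
  have "0 = colour_form n a (d p p) - colour_form n a (d p q) - colour_form n a (d r p) + colour_form n a (d r q)"
    using d pK q by simp
  also have "\<dots> = (\<Sum>x\<in>coords n. a x * of_bool (x = Edge {3, u}))"
    unfolding mixed_difference by (rule sum.cong) (simp_all only: eq)
  also have "\<dots> = a (Edge {3, u})"
    using u by (simp add: of_bool_def if_distrib cong: if_cong)
  finally show ?thesis by simp
qed

text \<open>Both 3 and \<open>u\<close> move between \<open>p\<close> and \<open>q\<close>, where
  \<open>v\<close> is alone at first. \<open>v\<close> represents \<open>q\<close> only if neither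
  joins it, and \<open>u\<close> only if it joins without 3, as \<open>u < v\<close>. The second
  difference is twice the edge coefficient, which is zero, plus that of \<open>v\<close> minus that
  of \<open>u\<close>.\<close>

lemma Rep_eq:
  assumes c: "colouring n K c" "c 1 = p" "c 2 = p" "c 3 = p" "c u = p"
    and v: "\<And>j. j \<in> {1..n} \<Longrightarrow> c j = q \<longleftrightarrow> j = v"
    and u: "u \<in> {4..n}" "v \<in> {4..n}" "u < v"
    and q: "q < K" "r < K" "q \<noteq> p" "r \<noteq> p" "q \<noteq> r"
  shows "a (Rep u) = a (Rep v)"
proof -
  define d where "d = (\<lambda>x y. c(2 := r, 3 := x, u := y))"
  have pK: "p < K"
    using colouring_less[OF c(1), of u] c u by simp
  have d: "colour_form n a (d x y) = b" if "x < K" "y < K" for x y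
  proof (rule face)
    show "colouring n K (d x y)"
      unfolding d_def using c u q that
      by (intro colouring_upd[where w = 1]) auto
    show "\<not> (d x y 1 = d x y 2 \<and> d x y 2 = d x y 3)"
      unfolding d_def using c u q by auto
  qed
  have cv: "c v = q" and before_v: "\<And>j. j \<in> {1..<v} \<Longrightarrow> c j \<noteq> q"
    using u v by auto
  have eq: "colour_val (d p p) x - colour_val (d p q) x - colour_val (d q p) x + colour_val (d q q) x =
      2 * of_bool (x = Edge {3, u}) + of_bool (x = Rep v) - of_bool (x = Rep u)" if "x \<in> coords n" for x
    using that
  proof (cases rule: coords_cases)
    case (1 i j)
    then show ?thesis
      using Edge_mixed_difference[of i j 3 u "c(2 := r)" p p q q] u q by (simp add: d_def)
  next
    case (2 w)
    \<comment> \<open>Vertices 1 and 2 have colours \<open>p\<close> and \<open>r\<close>, and 3 has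
      colour \<open>q\<close> when moved there; each precedes every \<open>w \<ge> 4\<close>, so
      \<open>w\<close> cannot represent such a colour.\<close>
    have p0: "colour_val (d x y) (Rep w) = 0" if "d x y w = p" for x y
    proof -
      have "\<exists>j\<in>{1..<w}. d x y j = d x y w"
        using 2 u c that by (intro bexI[of _ 1]) (auto simp: d_def)
      then show ?thesis by auto
    qed
    have r0: "colour_val (d x y) (Rep w) = 0" if "d x y w = r" for x y
    proof -
      have "\<exists>j\<in>{1..<w}. d x y j = d x y w"
        using 2 u c that by (intro bexI[of _ 2]) (auto simp: d_def)
      then show ?thesis by auto
    qed
    have q0: "colour_val (d q y) (Rep w) = 0" if "d q y w = q" for y
    proof -
      have "\<exists>j\<in>{1..<w}. d q y j = d q y w"
        using 2 u c that by (intro bexI[of _ 3]) (auto simp: d_def)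
      then show ?thesis by auto
    qed
    consider "w = u" | "w = v" | "w \<noteq> u" "w \<noteq> v" "c w = p \<or> c w = r"
      | "w \<noteq> u" "w \<noteq> v" "c w \<noteq> p" "c w \<noteq> r" by blast
    then show ?thesis
    proof cases
      case 1
      have "colour_val (d p q) (Rep u) = 1"
        using u c q v by (auto simp: d_def)
      moreover have "d x y u = y" for x y
        by (simp add: d_def)
      ultimately show ?thesis
        using p0[of p p] p0[of q p] q0[of q] 1 2 u by (simp del: colour_val.simps)
    next
      case w: 2
      have "d p p j \<noteq> q" if "j \<in> {1..<v}" for j
        using q before_v[OF that] by (simp add: d_def)
      moreover have "d p p v = q"
        using u cv by (simp add: d_def)
      ultimately have "colour_val (d p p) (Rep v) = 1"
        by simp
      moreover have "colour_val (d p q) (Rep v) = 0"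
        using u c q cv by (auto simp: d_def intro!: bexI[of _ u])
      moreover have "d x y v = q" for x y
        using u cv by (simp add: d_def)
      ultimately show ?thesis
        using q0[of p] q0[of q] w 2 u by (simp del: colour_val.simps)
    next
      case 3
      then have "d x y w = c w" for x y
        using 2 by (simp add: d_def)
      then have "colour_val (d x y) (Rep w) = 0" for x y
        using p0[of x y] r0[of x y] 3(3) by metis
      then show ?thesis
        using 3 2 by (simp del: colour_val.simps)
    next
      \<comment> \<open>The colour of \<open>w\<close> is none of \<open>p\<close>,
        \<open>q\<close>, \<open>r\<close>, so the class of \<open>w\<close> is the same in all four
        colourings.\<close>
      case 4
      moreover have "c w \<noteq> q" using v[of w] 4 2 by auto
      ultimately have "d x y j = d x y w \<longleftrightarrow> j \<noteq> 2 \<and> j \<noteq> 3 \<and> j \<noteq> u \<and> c j = c w"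
        if "x = p \<or> x = q" "y = p \<or> y = q" for x y j
        using 2 that by (cases "j = u"; cases "j = 3"; cases "j = 2") (auto simp: d_def)
      then have "colour_val (d x y) (Rep w) =
          of_bool (\<forall>j\<in>{1..<w}. \<not> (j \<noteq> 2 \<and> j \<noteq> 3 \<and> j \<noteq> u \<and> c j = c w))"
        if "x = p \<or> x = q" "y = p \<or> y = q" for x y
        using that by simp
      then show ?thesis
        using 4 2 by (simp del: colour_val.simps)
    qed
  qed
  have u0: "a (Edge {3, u}) = 0"
    using edge_3_eq_0[OF c u(1) q] .
  have "0 = colour_form n a (d p p) - colour_form n a (d p q) - colour_form n a (d q p) + colour_form n a (d q q)"
    using d pK q by simp
  also have "\<dots> = (\<Sum>x\<in>coords n. a x *
      (2 * of_bool (x = Edge {3, u}) + of_bool (x = Rep v) - of_bool (x = Rep u)))"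
    unfolding mixed_difference by (rule sum.cong) (simp_all only: eq)
  also have "\<dots> = (\<Sum>x\<in>coords n. (if x = Edge {3, u} then 2 * a x else 0) +
      (if x = Rep v then a x else 0) - (if x = Rep u then a x else 0))"
    by (rule sum.cong) auto
  also have "\<dots> = 2 * a (Edge {3, u}) + a (Rep v) - a (Rep u)"
    using u by (simp add: sum.distrib sum_subtractf)
  finally show ?thesis using u0 by simp
qed

text \<open>Vertices 1, 2, 3, \<open>u\<close> get colour 0 and \<open>v\<close> alone gets colour
  1. The other \<open>n - 5\<close> vertices have to cover \<open>K - 2\<close> colours, whence the
  bound on \<open>n\<close>.\<close>

lemma ex_colouring:
  assumes "n \<ge> K + 3" and uv: "u \<in> {4..n}" "v \<in> {4..n}" "u \<noteq> v"
  obtains c where "colouring n K c" "c 1 = 0" "c 2 = 0" "c 3 = 0" "c u = 0"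
    "\<And>j. j \<in> {1..n} \<Longrightarrow> c j = 1 \<longleftrightarrow> j = v"
proof -
  define A where "A = {4..n} - {u, v}"
  have "card A = n - 5"
    using uv by (simp add: A_def card_Diff_subset)
  then have "card {2..<K} \<le> card A"
    using assms by simp
  then obtain h where h: "h ` {2..<K} \<subseteq> A" "inj_on h {2..<K}"
    using card_le_inj[of "{2..<K}" A] by (auto simp: A_def)
  \<comment> \<open>\<open>h\<close> picks one vertex for each colour from 2 on; all spare vertices
    of \<open>A\<close> default to colour 2, which is available because
    \<open>K \<ge> 3\<close>.\<close>
  define g where "g = (\<lambda>x. if x \<in> h ` {2..<K} then inv_into {2..<K} h x else 2)"
  have g: "g ` A = {2..<K}"
  proof
    show "g ` A \<subseteq> {2..<K}"
      using K3 h by (auto simp: g_def)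
    show "{2..<K} \<subseteq> g ` A"
    proof
      fix k assume k: "k \<in> {2..<K}"
      then have "g (h k) = k" "h k \<in> A" using h by (auto simp: g_def)
      then show "k \<in> g ` A" by force
    qed
  qed
  define c where "c = (\<lambda>j. if j \<in> A then g j else if j = v then 1 else 0)"
  have A: "1 \<notin> A" "2 \<notin> A" "3 \<notin> A" "u \<notin> A" "v \<notin> A" "A \<subseteq> {1..n}"
    by (auto simp: A_def)
  have ge: "g j \<noteq> 1 \<and> g j < K" if "j \<in> A" for j
  proof -
    have "g j \<in> {2..<K}" using g that by blast
    then show ?thesis by simp
  qed
  have "k \<in> c ` {1..n}" if "k < K" for k
  proof -
    consider "k = 0" | "k = 1" | "k \<in> g ` A" using g \<open>k < K\<close> by force
    then show ?thesis
    proof cases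
      case 1
      then show ?thesis using uv A by (intro image_eqI[of _ _ u]) (auto simp: c_def)
    next
      case 2
      then show ?thesis using uv A by (intro image_eqI[of _ _ v]) (auto simp: c_def)
    next
      case 3
      then show ?thesis using A by (force simp: c_def)
    qed
  qed
  then have "colouring n K c"
    unfolding colouring_def using ge K3 by (auto simp: c_def)
  then show ?thesis
    using that[of c] uv A ge by (auto simp: c_def)
qed

lemma edge_3_eq_0':
  assumes "n \<ge> K + 3" "u \<in> {4..n}"
  shows "a (Edge {3, u}) = 0"
proof -
  \<comment> \<open>\<open>ex_colouring\<close> asks for a second vertex besides \<open>u\<close>; 4
    or 5 serves.\<close>
  obtain v where v: "v \<in> {4..n}" "u \<noteq> v"
  proof (cases "u = 4")
    case True
    then show ?thesis using that[of 5] assms K3 by simp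
  next
    case False
    then show ?thesis using that[of 4] assms K3 by simp
  qed
  obtain c where "colouring n K c" "c 1 = 0" "c 2 = 0" "c 3 = 0" "c u = 0"
    by (rule ex_colouring[OF assms v])
  then show ?thesis
    using edge_3_eq_0[of c 0 u 1 2] assms K3 by simp
qed

lemma Rep_const:
  assumes "n \<ge> K + 3" "u \<in> {4..n}" "v \<in> {4..n}"
  shows "a (Rep u) = a (Rep v)"
  using assms(2,3)
proof (induction u v rule: linorder_wlog)
  case (le u v)
  show ?case
  proof (cases "u = v")
    case False
    obtain c where "colouring n K c" "c 1 = 0" "c 2 = 0" "c 3 = 0" "c u = 0"
      "\<And>j. j \<in> {1..n} \<Longrightarrow> c j = 1 \<longleftrightarrow> j = v"
      by (rule ex_colouring[OF assms(1) le(2,3) False]) blast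
    then show ?thesis
      using Rep_eq[of c 0 u 1 v 2] le False K3 by simp
  qed simp
qed simp

text \<open>Moving 3 to another colour \<open>q\<close> reaches the face. This cuts the edges from 3
  to 1 and 2, and 3 replaces the former representative of \<open>q\<close>. Edges from 3 to later
  vertices have coefficient zero, and all \<open>Rep\<close> coefficients agree with that of
  4.\<close>

lemma off_face_value:
  assumes n: "n \<ge> K + 3" and c: "colouring n K c" "c 1 = c 2" "c 2 = c 3"
  shows "colour_form n a c = b + a (Edge {1, 3}) + a (Edge {2, 3}) + a (Rep 4)"
proof -
  obtain q where q: "q < K" "q \<noteq> c 1"
    using K3 by (cases "c 1 = 0") (auto intro: that[of 0] that[of 1])
  obtain i where i: "i \<in> {1..n}" "c i = q"
    using colouring_surj[OF c(1) q(1)] .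
  \<comment> \<open>The representative of \<open>q\<close>. It exceeds 3, because 1, 2, 3 all have
    the colour \<open>c 1\<close>, so it loses its role when 3 joins its cluster.\<close>
  define m where "m = (LEAST i. i \<in> {1..n} \<and> c i = q)"
  have m: "m \<in> {1..n} \<and> c m = q"
    unfolding m_def by (rule LeastI[of _ i]) (use i in simp)
  have least: "c j \<noteq> q" if "j \<in> {1..<m}" for j
    using not_less_Least[of j "\<lambda>i. i \<in> {1..n} \<and> c i = q"] m that unfolding m_def[symmetric] by auto
  have "m \<noteq> 1" "m \<noteq> 2" "m \<noteq> 3"
    using m c q by auto
  then have m4: "m \<in> {4..n}"
    using m by auto
  let ?d = "c(3 := q)"
  have "colouring n K ?d"
    using c q n by (intro colouring_upd[where w = 1]) auto
  then have d: "colour_form n a ?d = b"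
    using c q by (intro face) auto
  have eq: "a x * colour_val c x - a x * colour_val ?d x =
      (if x = Edge {1, 3} then a x else 0) + (if x = Edge {2, 3} then a x else 0) +
      (if x = Rep m then a x else 0)" if "x \<in> coords n" for x
    using that
  proof (cases rule: coords_cases)
    case (1 i j)
    have edge: ?thesis if w: "x = Edge {3, w}" "w \<in> {1..n}" "w \<noteq> 3" for w
    proof -
      consider "w = 1" | "w = 2" | "w \<in> {4..n}"
        using w by force
      then show ?thesis
      proof cases
        case 3
        then show ?thesis using edge_3_eq_0'[OF n 3] w by (auto simp: doubleton_eq_iff)
      qed (use w c q in \<open>auto simp: doubleton_eq_iff\<close>)
    qed
    show ?thesis
    proof (cases "i = 3 \<or> j = 3")
      case True
      then have "x = Edge {3, j} \<and> j \<noteq> 3 \<or> x = Edge {3, i} \<and> i \<noteq> 3"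
        using 1 by (auto simp: insert_commute)
      then show ?thesis using edge 1(3,4) by blast
    next
      case False
      then show ?thesis using 1 by (auto simp: doubleton_eq_iff)
    qed
  next
    case (2 w)
    consider "c w = c 1" | "w = m" | "c w = q" "w \<noteq> m" | "c w \<noteq> c 1" "c w \<noteq> q" by blast
    then show ?thesis
    proof cases
      case 1
      then have "\<exists>j\<in>{1..<w}. c j = c w" "\<exists>j\<in>{1..<w}. ?d j = ?d w"
        using 2 by (auto intro!: bexI[of _ 1])
      then have "colour_val c x = 0" "colour_val ?d x = 0"
        using 2 by auto
      moreover have "w \<noteq> m" using 1 m q by auto
      ultimately show ?thesis using 2 by (simp del: colour_val.simps)
    next
      case w: 2
      have "\<exists>j\<in>{1..<w}. ?d j = ?d w"
        using 2 w m by (intro bexI[of _ 3]) auto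
      then have "colour_val ?d x = 0"
        using 2 by auto
      moreover have "colour_val c x = 1"
        using 2 w m least by auto
      ultimately show ?thesis using 2 w by (simp del: colour_val.simps)
    next
      case 3
      then have "m < w"
        using least[of w] 2 by force
      then have "\<exists>j\<in>{1..<w}. c j = c w" "\<exists>j\<in>{1..<w}. ?d j = ?d w"
        using 2 3 m m4 by (auto intro!: bexI[of _ m])
      then have "colour_val c x = 0" "colour_val ?d x = 0"
        using 2 by auto
      then show ?thesis using 3 2 by (simp del: colour_val.simps)
    next
      case 4
      have "c j \<noteq> c w \<longleftrightarrow> ?d j \<noteq> ?d w" for j
        using 4 2 c by auto
      then have "colour_val c x = colour_val ?d x"
        using 2 by (simp del: fun_upd_apply)
      moreover have "w \<noteq> m" using 4 m by auto
      ultimately show ?thesis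
        using 2 by (simp del: colour_val.simps)
    qed
  qed
  have "colour_form n a c - b = colour_form n a c - colour_form n a ?d"
    using d by simp
  also have "\<dots> = (\<Sum>x\<in>coords n. (if x = Edge {1, 3} then a x else 0) +
      (if x = Edge {2, 3} then a x else 0) + (if x = Rep m then a x else 0))"
    unfolding colour_form_def sum_subtractf[symmetric] by (rule sum.cong) (simp_all only: eq)
  also have "\<dots> = a (Edge {1, 3}) + a (Edge {2, 3}) + a (Rep m)"
    using m4 by (simp add: sum.distrib)
  finally show ?thesis
    using Rep_const[OF n m4, of 4] m4 by simp
qed

text \<open>If \<open>n \<ge> K + 3\<close>, the formula of \<open>off_face_value\<close> does not
  mention the colouring. For smaller \<open>n\<close>, counting leaves a single partition with 1, 2,
  3 together.\<close>

lemma off_face_const: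
  assumes n: "n \<ge> 3"
    and c: "colouring n K c" "c 1 = c 2" "c 2 = c 3"
    and c': "colouring n K c'" "c' 1 = c' 2" "c' 2 = c' 3"
  shows "colour_form n a c = colour_form n a c'"
proof (cases "n \<ge> K + 3")
  case True
  then show ?thesis
    using off_face_value c c' by metis
next
  case False
  \<comment> \<open>Here \<open>n = K + 2\<close>, and \<open>{1, 2, 3}\<close> with singletons is the only partition off the face.\<close>
  have max: "f i = f j \<longleftrightarrow> max 3 i = max 3 j"
    if f: "colouring n K f" "f 1 = f 2" "f 2 = f 3" and ij: "i \<in> {1..n}" "j \<in> {1..n}" for f i j
  proof -
    have fm: "f i = f (max 3 i)" if "i \<in> {1..n}" for i
    proof -
      have "i = 1 \<or> i = 2 \<or> i \<ge> 3" using that by auto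
      then show ?thesis using f by (auto simp: max_def)
    qed
    have "{..<K} = f ` {3..n}"
    proof
      show "{..<K} \<subseteq> f ` {3..n}"
      proof
        fix k assume "k \<in> {..<K}"
        then have "k \<in> f ` {1..n}" using f(1) by (simp add: colouring_def)
        then obtain i where "i \<in> {1..n}" "k = f i" by blast
        then show "k \<in> f ` {3..n}"
          using fm[of i] n by (intro image_eqI[of _ _ "max 3 i"]) auto
      qed
      show "f ` {3..n} \<subseteq> {..<K}"
        using f(1) unfolding colouring_def by auto
    qed
    then have K: "card (f ` {3..n}) = K" by (metis card_lessThan)
    moreover have "card (f ` {3..n}) \<le> n - 2"
      using card_image_le[of "{3..n}" f] by simp
    \<comment> \<open>The \<open>K\<close> colours all occur on the \<open>n - 2\<close> vertices
      from 3 on, and \<open>n < K + 3\<close> gives the reverse bound, so no two of these vertices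
      share a colour.\<close>
    ultimately have "card (f ` {3..n}) = card {3..n}"
      using False by simp
    then have "inj_on f {3..n}"
      by (intro eq_card_imp_inj_on) auto
    then have "f (max 3 i) = f (max 3 j) \<longleftrightarrow> max 3 i = max 3 j"
      using ij n by (intro inj_on_eq_iff) auto
    then show ?thesis
      using fm ij by simp
  qed
  have same: "c i = c j \<longleftrightarrow> c' i = c' j" if "i \<in> {1..n}" "j \<in> {1..n}" for i j
    using max[OF c that] max[OF c' that] by simp
  have "colour_val c x = colour_val c' x" if "x \<in> coords n" for x
    using that
  proof (cases rule: coords_cases)
    case (1 i j)
    then show ?thesis using same[of i j] by (simp only: colour_val_Edge)
  next
    case (2 u)
    have "c j \<noteq> c u \<longleftrightarrow> c' j \<noteq> c' u" if "j \<in> {1..<u}" for j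
      using same[of j u] 2 that by auto
    then have "(\<forall>j\<in>{1..<u}. c j \<noteq> c u) \<longleftrightarrow> (\<forall>j\<in>{1..<u}. c' j \<noteq> c' u)"
      by (rule ball_cong[OF refl])
    then show ?thesis using 2 by simp
  qed
  then show ?thesis
    by (simp add: colour_form_def)
qed

end

section \<open>Transfer to the polytope and the dimension of the face\<close>

definition colour_vec :: "nat \<Rightarrow> (coord \<Rightarrow> 'c) \<Rightarrow> (nat \<Rightarrow> nat) \<Rightarrow> real ^ 'c::finite" where
  "colour_vec n pos c = (\<chi> i. colour_val c (inv_into (coords n) pos i))"

lemma colour_vec_nth:
  assumes "bij_betw pos (coords n) UNIV" "x \<in> coords n"
  shows "colour_vec n pos c $ pos x = colour_val c x"
  using assms by (simp add: colour_vec_def bij_betw_def)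

lemma partition_polytope_eq:
  assumes pos: "bij_betw pos (coords n) (UNIV :: 'c::finite set)"
  shows "partition_polytope n K pos = convex hull (colour_vec n pos ` {c. colouring n K c})"
proof -
  have inv: "inv_into (coords n) pos i \<in> coords n" for i
    using pos by (metis UNIV_I bij_betw_imp_surj_on inv_into_into)
  have eq: "char_vec n pos \<pi> = colour_vec n pos c" if "\<forall>x\<in>coords n. coord_val \<pi> x = colour_val c x" for \<pi> c
    using that inv by (simp add: char_vec_def colour_vec_def)
  have "char_vec n pos ` {\<pi>. K_partition n K \<pi>} = colour_vec n pos ` {c. colouring n K c}"
  proof (intro equalityI subsetI)
    fix x assume "x \<in> char_vec n pos ` {\<pi>. K_partition n K \<pi>}"
    then show "x \<in> colour_vec n pos ` {c. colouring n K c}"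
      using partition_imp_colouring eq by blast
  next
    fix x assume "x \<in> colour_vec n pos ` {c. colouring n K c}"
    then obtain c where "colouring n K c" "x = colour_vec n pos c" by blast
    with colouring_imp_partition eq show "x \<in> char_vec n pos ` {\<pi>. K_partition n K \<pi>}"
      by (metis image_eqI mem_Collect_eq)
  qed
  then show ?thesis
    by (simp add: partition_polytope_def)
qed

text \<open>This links hyperplanes of the ambient space to \<open>face_form\<close>: a normal vector
  is a choice of coefficients.\<close>

lemma inner_colour_vec:
  assumes pos: "bij_betw pos (coords n) (UNIV :: 'c::finite set)"
  shows "w \<bullet> colour_vec n pos c = colour_form n (\<lambda>x. w $ pos x) c"
proof -
  have "w \<bullet> colour_vec n pos c = (\<Sum>i\<in>UNIV. w $ i * colour_vec n pos c $ i)"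
    by (simp add: inner_vec_def)
  also have "\<dots> = (\<Sum>x\<in>coords n. w $ pos x * colour_vec n pos c $ pos x)"
    by (rule sum.reindex_bij_betw[OF pos, symmetric])
  finally show ?thesis
    by (simp add: colour_form_def colour_vec_nth[OF pos])
qed

lemma affine_level_set:
  fixes f :: "'a::real_vector \<Rightarrow> real"
  assumes "linear f"
  shows "affine {x. f x = b}"
proof -
  have "u * b + v * b = b" if "u + v = 1" for u v
    using that by (metis distrib_right mult_1)
  then show ?thesis
    using assms by (simp add: affine_def linear_add linear_scale)
qed

theorem theorem4p6:
  fixes n K :: nat
    and pos :: "coord \<Rightarrow> 'c::finite"
  assumes pos: "bij_betw pos (coords n) (UNIV :: 'c set)"
    and full_dim: "aff_dim (partition_polytope n K pos) = int (DIM(real ^ 'c))"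
  shows "facet_defining (partition_polytope n K pos)
           (\<lambda>x. x $ pos (Edge {1, 2}) + x $ pos (Edge {1, 3}) + x $ pos (Edge {2, 3})
                - (\<Sum>i = 4..n. x $ pos (Rep i)))
           (3 - real K)"
proof -
  define P where "P = partition_polytope n K pos"
  define V where "V = colour_vec n pos ` {c. colouring n K c}"
  define f :: "real ^ 'c \<Rightarrow> real" where
    "f = (\<lambda>x. x $ pos (Edge {1, 2}) + x $ pos (Edge {1, 3}) + x $ pos (Edge {2, 3})
                - (\<Sum>i = 4..n. x $ pos (Rep i)))"
  define F where "F = {x \<in> P. f x = 3 - real K}"
  have P: "P = convex hull V"
    unfolding P_def V_def by (rule partition_polytope_eq[OF pos])
  have full: "affine hull V = UNIV"
    using full_dim aff_dim_eq_full[of P] affine_hull_convex_hull[of V]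
    unfolding P_def[symmetric] P by simp
  \<comment> \<open>Full-dimensionality in usable form: an equation satisfied by all vertices holds
    on the whole space. Degenerate parameters are refuted by exhibiting such an equation.\<close>
  have no_eq: "g x = \<beta>"
    if "linear g" "\<And>c. colouring n K c \<Longrightarrow> g (colour_vec n pos c) = \<beta>" for g :: "real ^ 'c \<Rightarrow> real" and \<beta> x
  proof -
    have "affine hull V \<subseteq> {x. g x = \<beta>}"
      by (rule hull_minimal) (use that affine_level_set in \<open>auto simp: V_def\<close>)
    then show ?thesis using full by auto
  qed
  note nth = colour_vec_nth[OF pos]
  have edge: "colour_vec n pos c $ pos (Edge {i, j}) = of_bool (c i = c j)"
    if "i \<noteq> j" "i \<in> {1..n}" "j \<in> {1..n}" for c i j
  proof -
    have "Edge {i, j} \<in> coords n" using that by simp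
    then show ?thesis by (simp only: nth colour_val_Edge)
  qed
  \<comment> \<open>The index type is non-empty, so there is at least one coordinate, which requires
    two vertices.\<close>
  have n2: "n \<ge> 2"
  proof (rule ccontr)
    assume "\<not> n \<ge> 2"
    have "x \<notin> coords n" for x
    proof
      assume "x \<in> coords n"
      then show False
        by (cases rule: coords_cases) (use \<open>\<not> n \<ge> 2\<close> in auto)
    qed
    then have "coords n = {}" by blast
    with pos show False by (simp add: bij_betw_def)
  qed
  have lin12: "linear (\<lambda>x::real^'c. x $ pos (Edge {1, 2}))"
    by (rule linearI) simp_all
  have K2: "K \<ge> 2"
  proof (rule ccontr)
    assume "\<not> K \<ge> 2"
    have "c 1 = c 2" if "colouring n K c" for c
    proof -
      have "c 1 < K" "c 2 < K"
        using colouring_less[OF that] n2 by auto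
      then show ?thesis using \<open>\<not> K \<ge> 2\<close> by simp
    qed
    then have "colour_vec n pos c $ pos (Edge {1, 2}) = 1" if "colouring n K c" for c
      using n2 edge[of 1 2] that by simp
    then have "(0::real^'c) $ pos (Edge {1, 2}) = 1"
      by (rule no_eq[OF lin12])
    then show False by simp
  qed
  have n3: "n \<ge> 3"
  proof (rule ccontr)
    assume "\<not> n \<ge> 3"
    then have "n = 2" using n2 by simp
    \<comment> \<open>For two vertices, counting representatives already fixes the only
      coordinate.\<close>
    have "of_bool (c 1 = c 2) = 2 - real K" if "colouring n K c" for c
    proof -
      have "{1..n} = {1, 2}" "{1..<2} = {1::nat}" using \<open>n = 2\<close> by auto
      then have "(\<Sum>i\<in>{1, 2}. colour_val c (Rep i)) = real K"
        "colour_val c (Rep 1) = 1" "colour_val c (Rep 2) = of_bool (c 1 \<noteq> c 2)"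
        using sum_Rep_colour_val[OF that] by auto
      moreover have "(\<Sum>i\<in>{1, 2}. colour_val c (Rep i)) = colour_val c (Rep 1) + colour_val c (Rep 2)"
        by (simp del: colour_val.simps)
      ultimately have "1 + of_bool (c 1 \<noteq> c 2) = real K"
        by linarith
      then show ?thesis by (cases "c 1 = c 2") auto
    qed
    then have "colour_vec n pos c $ pos (Edge {1, 2}) = 2 - real K" if "colouring n K c" for c
      using n2 edge[of 1 2] that by simp
    then have *: "(x::real^'c) $ pos (Edge {1, 2}) = 2 - real K" for x
      by (rule no_eq[OF lin12])
    show False
      using *[of 0] *[of "\<chi> i. 1"] by simp
  qed
  have linf: "linear f"
    by (rule linearI) (simp_all add: f_def sum.distrib sum_distrib_left algebra_simps)
  have f_vec: "f (colour_vec n pos c) = 3 - real K + of_bool (c 1 = c 2 \<and> c 2 = c 3)"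
    if "colouring n K c" for c
  proof -
    have "(\<Sum>i = 4..n. colour_vec n pos c $ pos (Rep i)) = (\<Sum>i = 4..n. colour_val c (Rep i))"
      by (rule sum.cong) (simp_all add: nth del: colour_val.simps)
    then show ?thesis
      using n3 sum_Rep_from_4[OF that n3] edge[of 1 2 c] edge[of 1 3 c] edge[of 2 3 c]
      by (cases "c 1 = c 2"; cases "c 1 = c 3"; cases "c 2 = c 3")
        (simp_all add: f_def del: colour_val.simps)
  qed
  have K3: "K \<ge> 3"
  proof (rule ccontr)
    assume "\<not> K \<ge> 3"
    then have "K = 2" using K2 by simp
    \<comment> \<open>With two colours, the sum of the edges among 1, 2, 3 is 3 if they share a
      colour and 1 otherwise, while the number of later representatives is 1 or 0 respectively; so
      \<open>g\<close> is constantly 1 on the vertices.\<close>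
    define g :: "real ^ 'c \<Rightarrow> real" where
      "g = (\<lambda>x. x $ pos (Edge {1, 2}) + x $ pos (Edge {1, 3}) + x $ pos (Edge {2, 3})
                - 2 * (\<Sum>i = 4..n. x $ pos (Rep i)))"
    have "linear g"
      by (rule linearI) (simp_all add: g_def sum.distrib sum_distrib_left algebra_simps)
    moreover have "g (colour_vec n pos c) = 1" if c: "colouring n K c" for c
    proof -
      have "c 1 < 2" "c 2 < 2" "c 3 < 2"
        using colouring_less[OF c] n3 \<open>K = 2\<close> by auto
      moreover have "(\<Sum>i = 4..n. colour_vec n pos c $ pos (Rep i)) = (\<Sum>i = 4..n. colour_val c (Rep i))"
        by (rule sum.cong) (simp_all add: nth del: colour_val.simps)
      ultimately show ?thesis
        using n3 sum_Rep_from_4[OF c n3] edge[of 1 2 c] edge[of 1 3 c] edge[of 2 3 c] \<open>K = 2\<close>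
        by (cases "c 1 = c 2"; cases "c 1 = c 3"; cases "c 2 = c 3")
          (simp_all add: g_def del: colour_val.simps)
    qed
    ultimately have "g 0 = 1" by (rule no_eq)
    then show False by (simp add: g_def)
  qed
  have valid: "f x \<ge> 3 - real K" if "x \<in> P" for x
  proof -
    have "convex {x. f x \<ge> 3 - real K}"
      using convex_linear_vimage[OF linf, of "{3 - real K..}"] by (simp add: vimage_def)
    then have "P \<subseteq> {x. f x \<ge> 3 - real K}"
      unfolding P by (intro hull_minimal) (auto simp: V_def f_vec)
    then show ?thesis using that by auto
  qed
  \<comment> \<open>Without a vertex off the face, \<open>f\<close> would be constant on the whole
    space, yet it is 0 at the origin and 1 at a unit vector.\<close>
  have "\<exists>c. colouring n K c \<and> c 1 = c 2 \<and> c 2 = c 3"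
  proof (rule ccontr)
    assume "\<not> ?thesis"
    then have "f (colour_vec n pos c) = 3 - real K" if "colouring n K c" for c
      using f_vec[OF that] that by auto
    then have *: "f x = 3 - real K" for x
      by (rule no_eq[OF linf])
    define y :: "real ^ 'c" where "y = axis (pos (Edge {1, 2})) 1"
    have "pos x = pos (Edge {1, 2}) \<longleftrightarrow> x = Edge {1, 2}" if "x \<in> coords n" for x
      using pos that n3 by (intro inj_on_eq_iff[of pos "coords n"]) (auto simp: bij_betw_def)
    then have "f y = 1"
      using n3 by (simp add: f_def y_def axis_def doubleton_eq_iff)
    then show False
      using *[of y] *[of 0] by (simp add: f_def)
  qed
  then obtain c0 where c0: "colouring n K c0" "c0 1 = c0 2" "c0 2 = c0 3"
    by blast
  define v where "v = colour_vec n pos c0"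
  \<comment> \<open>The affine hull is an intersection of hyperplanes. If it missed a vertex
    \<open>y\<close>, some functional would be constant on \<open>F\<close> and \<open>v\<close> but
    differ at \<open>y\<close>; \<open>face_form\<close> excludes this, since \<open>y\<close> lies
    on the face or has the same value as \<open>v\<close>.\<close>
  have "V \<subseteq> affine hull (insert v F)"
  proof
    fix y assume "y \<in> V"
    then obtain c where c: "colouring n K c" "y = colour_vec n pos c"
      by (auto simp: V_def)
    show "y \<in> affine hull (insert v F)"
    proof (rule ccontr)
      assume "y \<notin> affine hull (insert v F)"
      moreover obtain \<H> where \<H>: "affine hull (insert v F) = \<Inter>\<H>"
        "\<And>h. h \<in> \<H> \<Longrightarrow> \<exists>w b. w \<noteq> 0 \<and> h = {x. w \<bullet> x = b}"
        using affine_hull_finite_intersection_hyperplanes[of "insert v F"] by metis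
      ultimately obtain h where h: "h \<in> \<H>" "y \<notin> h"
        by blast
      then obtain w b where "h = {x. w \<bullet> x = b}"
        using \<H>(2) by blast
      with h \<H>(1) have wb: "w \<bullet> y \<noteq> b" "affine hull (insert v F) \<subseteq> {x. w \<bullet> x = b}"
        by blast+
      then have w: "w \<bullet> x = b" if "x \<in> insert v F" for x
        using that hull_inc[of x "insert v F" affine] by blast
      interpret face_form n K "\<lambda>x. w $ pos x" b
      proof
        fix c assume "colouring n K c" "\<not> (c 1 = c 2 \<and> c 2 = c 3)"
        then have "colour_vec n pos c \<in> F"
          using f_vec hull_inc[of "colour_vec n pos c" V convex] by (auto simp: F_def P V_def)
        then show "colour_form n (\<lambda>x. w $ pos x) c = b"
          using w by (simp flip: inner_colour_vec[OF pos])
      qed (rule K3)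
      have "colour_form n (\<lambda>x. w $ pos x) c = b"
      proof (cases "c 1 = c 2 \<and> c 2 = c 3")
        case True
        then show ?thesis
          using off_face_const[OF n3 c(1) _ _ c0] w[of v] inner_colour_vec[OF pos, of w c0]
          by (simp add: v_def)
      next
        case False
        then show ?thesis using face c by blast
      qed
      then show False
        using wb c inner_colour_vec[OF pos] by metis
    qed
  qed
  then have "affine hull (insert v F) = UNIV"
    using full hull_minimal[of V "affine hull (insert v F)" affine] by auto
  \<comment> \<open>Adding the one point \<open>v\<close> raises the dimension by at most 1, which
    bounds that of \<open>F\<close> from below.\<close>
  then have "int (DIM(real ^ 'c)) \<le> aff_dim F + 1"
    using aff_dim_eq_full[of "insert v F"] aff_dim_insert[of v F] by (auto split: if_splits)
  moreover have "aff_dim F \<noteq> int (DIM(real ^ 'c))"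
  proof
    assume "aff_dim F = int (DIM(real ^ 'c))"
    then have "affine hull F = UNIV"
      using aff_dim_eq_full by blast
    moreover have "affine hull F \<subseteq> {x. f x = 3 - real K}"
      by (rule hull_minimal) (use affine_level_set[OF linf] in \<open>auto simp: F_def\<close>)
    ultimately have "f v = 3 - real K" by auto
    then show False
      using f_vec c0 by (simp add: v_def)
  qed
  moreover have "aff_dim F \<le> int (DIM(real ^ 'c))"
    by (rule aff_dim_le_DIM)
  ultimately have "aff_dim F = aff_dim P - 1"
    using full_dim by (simp add: P_def)
  then show ?thesis
    using linf valid unfolding facet_defining_def F_def P_def[symmetric] f_def[symmetric] by simp
qed

end
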